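(* Let $N>K\ge2$ and let $X=(x_1,x_2,\dots,x_K)$ be a real $N\times K$ matrix of rank $K$ with $x_1=e=(1,\dots,1)'$. Let $Z^*=(z_2,\dots,z_K)$ be the $N\times(K-1)$ matrix of standardized variables, $z_j=(z_{1j},\dots,z_{Nj})'$ with $$z_{nj}=\frac{x_{nj}-\bar x_j}{\sqrt N\, s_{xj}}\qquad(j\ge 2,\ n=1,\dots,N).$$ Then for every $k\ge 2$, $$\check R_k^2(X)=\check R_k^2(Z^* ),$$ where $\check R_k^2(X)$ is the coefficient of determination of $x_k$ regressed on the remaining columns of $X$ (including $e$), and $\check R_k^2(Z^* )$ is the coefficient of determination of $z_k$ regressed on the remaining columns of $Z^*$.
   Context: Here $\bar x_j=\frac1N\sum_{n=1}^N x_{nj}$ and $s_{xj}^2=\frac1N\sum_{n=1}^N(x_{nj}-\bar x_j)^2$ with $s_{xj}>0$ (positive by the rank assumption), so $e'z_j=0$ and $z_j'z_j=1$. With $M_e=e(e'e)^{-1}e'$: let $\check X_k$ be $X$ with the column $x_k$ deleted and $\hat x_k=\check X_k(\check X_k'\check X_k)^{-1}\check X_k'x_k$ the least squares fit; then $\check R_k^2(X)=\hat x_k'(I-M_e)\hat x_k/[x_k'(I-M_e)x_k]$. Let $\check Z_k^*$ be $Z^*$ with the column $z_k$ deleted and $\hat z_k=\check Z_k^*(\check Z_k^{*\prime}\check Z_k^* )^{-1}\check Z_k^{*\prime}z_k$ the least squares fit (equal to $0$ if $\check Z_k^*$ has no columns); since all $z_j$ have mean zero, the coefficient of determination is $\check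 R_k^2(Z^* )=\hat z_k'\hat z_k/(z_k'z_k)=\hat z_k'\hat z_k$. *)

theory Defs
  imports
    Complex_Main
    "Jordan_Normal_Form.Matrix"
    "Jordan_Normal_Form.Gauss_Jordan_Elimination"
    "Jordan_Normal_Form.DL_Rank"
begin

text \<open>
  All indices start at \<open>0\<close>: the constant column \<open>e\<close> of the design matrix is column \<open>0\<close>, and
  the standardized version of column \<open>Suc j\<close> is column \<open>j\<close> of \<open>standardized_mat\<close>.
\<close>

definition vec_mean :: "real vec \<Rightarrow> real" where
  "vec_mean v = (1 / real (dim_vec v)) * (\<Sum>n<dim_vec v. v $ n)"

text \<open>The divisor is the sample size, not the sample size minus one.\<close>

definition vec_sd :: "real vec \<Rightarrow> real" where
  "vec_sd v = sqrt ((1 / real (dim_vec v)) * (\<Sum>n<dim_vec v. (v $ n - vec_mean v)\<^sup>2))"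

definition standardize :: "real vec \<Rightarrow> real vec" where
  "standardize v =
     vec (dim_vec v) (\<lambda>n. (v $ n - vec_mean v) / (sqrt (real (dim_vec v)) * vec_sd v))"

definition standardized_mat :: "real mat \<Rightarrow> real mat" where
  "standardized_mat X =
     mat (dim_row X) (dim_col X - 1) (\<lambda>(n, j). standardize (col X (Suc j)) $ n)"

definition delete_col :: "nat \<Rightarrow> 'a mat \<Rightarrow> 'a mat" where
  "delete_col k A =
     mat (dim_row A) (dim_col A - 1) (\<lambda>(i, j). A $$ (i, if j < k then j else Suc j))"

text \<open>
  \<open>A (A' A)\<^sup>-\<^sup>1 A'\<close>, meaningful when \<open>A\<close> has full column rank, so that \<open>mat_inverse\<close> returns
  \<open>Some\<close>. If \<open>A\<close> has no columns, this is the zero matrix (the sums in the product are empty).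
\<close>

definition proj_mat :: "real mat \<Rightarrow> real mat" where
  "proj_mat A = A * the (mat_inverse (A\<^sup>T * A)) * A\<^sup>T"

definition ones_vec :: "nat \<Rightarrow> real vec" where
  "ones_vec N = vec N (\<lambda>_. 1)"

definition M_e :: "nat \<Rightarrow> real mat" where
  "M_e N = proj_mat (mat_of_cols N [ones_vec N])"

definition ls_fit :: "real mat \<Rightarrow> nat \<Rightarrow> real vec" where
  "ls_fit A k = proj_mat (delete_col k A) *\<^sub>v col A k"

text \<open>
  The coefficient of determination of column \<open>k\<close> regressed on the other columns: with sums of
  squares about the mean for a design containing the constant column, and with plain sums of
  squares for a design whose columns all have mean zero.
\<close>

definition R2_const :: "real mat \<Rightarrow> nat \<Rightarrow> real" where
  "R2_const X k =
     (let C = 1\<^sub>m (dim_row X) - M_e (dim_row X)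
      in (ls_fit X k \<bullet> (C *\<^sub>v ls_fit X k)) / (col X k \<bullet> (C *\<^sub>v col X k)))"

definition R2_centered :: "real mat \<Rightarrow> nat \<Rightarrow> real" where
  "R2_centered Z k = (ls_fit Z k \<bullet> ls_fit Z k) / (col Z k \<bullet> col Z k)"

end

theory Submission
  imports Defs
begin

text \<open>
  Centering, \<open>v \<mapsto> v - mean(v) e\<close>, is linear and kills \<open>e\<close>; it maps the column space of a design
  containing \<open>e\<close> into that of the standardized design and carries normal equations to normal
  equations. As least squares fits are characterized by being in the column space and
  satisfying the normal equations, the fit of \<open>z\<^sub>k\<close> is a scalar multiple of the centered fit of
  \<open>x\<^sub>k\<close>, with the same scalar relating \<open>z\<^sub>k\<close> to the centered \<open>x\<^sub>k\<close>. The scalar cancels in the ratio.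
\<close>

section \<open>Full column rank as injectivity\<close>

definition full_col_rank :: "'a :: semiring_0 mat \<Rightarrow> bool" where
  "full_col_rank A \<longleftrightarrow>
     (\<forall>v \<in> carrier_vec (dim_col A). A *\<^sub>v v = 0\<^sub>v (dim_row A) \<longrightarrow> v = 0\<^sub>v (dim_col A))"

lemma full_col_rankD:
  assumes "full_col_rank A" "A \<in> carrier_mat n m" "v \<in> carrier_vec m" "A *\<^sub>v v = 0\<^sub>v n"
  shows "v = 0\<^sub>v m"
  using assms unfolding full_col_rank_def by auto

text \<open>A maximal independent subset of the columns has \<open>rank A = nc\<close> elements, so
  the \<open>nc\<close> columns are pairwise distinct. Distinctness is needed because independence
  is stated for the set of columns: only then does a nonzero kernel vector give a linear
  dependence.\<close>

lemma (in vec_space) full_col_rank_if_rank: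
  assumes A: "A \<in> carrier_mat n nc" and rank: "rank A = nc"
  shows "full_col_rank A"
proof -
  let ?P = "\<lambda>T. T \<subseteq> set (cols A) \<and> lin_indpt T"
  have "lin_indpt {}"
    using subset_li_is_li[of "set (unit_vecs n)" "{}"] unit_vecs_basis unfolding basis_def by simp
  then have "\<exists>S. finite S \<and> maximal S ?P \<and> {} \<subseteq> S"
    by (intro maximal_exists_superset[of "set (cols A)"]) simp_all
  then obtain S where S: "maximal S ?P"
    by metis
  have "nc \<le> card (set (cols A))"
    using rank_card_indpt[OF A S] S rank by (simp add: card_mono maximal_def)
  moreover have "length (cols A) = nc"
    using A by simp
  ultimately have "distinct (cols A)"
    using card_length[of "cols A"] by (intro card_distinct) linarith
  then show ?thesis
    using full_rank_lin_indpt[OF A rank] lin_depI[OF A] A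
    unfolding full_col_rank_def by (metis carrier_matD)
qed

lemma full_col_rank_mult:
  assumes A: "A \<in> carrier_mat n m" and B: "B \<in> carrier_mat m l"
    and "full_col_rank A" "full_col_rank B"
  shows "full_col_rank (A * B)"
  unfolding full_col_rank_def
proof (intro ballI impI)
  fix v assume v: "v \<in> carrier_vec (dim_col (A * B))"
    and 0: "A * B *\<^sub>v v = 0\<^sub>v (dim_row (A * B))"
  then have "A *\<^sub>v (B *\<^sub>v v) = 0\<^sub>v n"
    using A B by simp
  then have "B *\<^sub>v v = 0\<^sub>v m"
    using full_col_rankD[OF assms(3) A] B v by simp
  then show "v = 0\<^sub>v (dim_col (A * B))"
    using full_col_rankD[OF assms(4) B] B v by simp
qed

section \<open>Deleting a column\<close>

lemma delete_col_carrier: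
  assumes "A \<in> carrier_mat n m"
  shows "delete_col k A \<in> carrier_mat n (m - 1)"
  using assms by (simp add: delete_col_def)

lemma col_delete_col:
  assumes "A \<in> carrier_mat n m" and "j < m - 1"
  shows "col (delete_col k A) j = col A (if j < k then j else Suc j)"
  using assms by (intro eq_vecI) (auto simp: delete_col_def)

text \<open>Deletion is multiplication by a selection matrix, so that preservation of full rank
  becomes an instance of \<open>full_col_rank_mult\<close>. For \<open>k >= m\<close> both sides
  drop the last column, hence no bound on \<open>k\<close>.\<close>

lemma delete_col_eq_mult:
  fixes A :: "'a :: semiring_1 mat"
  assumes A: "A \<in> carrier_mat n m"
  shows "delete_col k A = A * delete_col k (1\<^sub>m m)"
proof (rule eq_matI)
  let ?D = "delete_col k (1\<^sub>m m) :: 'a mat"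
  fix i j assume "i < dim_row (A * ?D)" "j < dim_col (A * ?D)"
  then have ij: "i < n" "j < m - 1"
    using A by (auto simp: delete_col_def)
  then have "col ?D j = unit_vec m (if j < k then j else Suc j)"
    by (subst col_delete_col[of _ m]) auto
  then show "delete_col k A $$ (i, j) = (A * ?D) $$ (i, j)"
    using A ij by (auto simp: delete_col_def)
qed (use A in \<open>auto simp: delete_col_def\<close>)

lemma full_col_rank_delete_col_one:
  "full_col_rank (delete_col k (1\<^sub>m m) :: 'a :: semiring_1 mat)"
  unfolding full_col_rank_def
proof (intro ballI impI)
  let ?D = "delete_col k (1\<^sub>m m) :: 'a mat"
  fix v assume v: "v \<in> carrier_vec (dim_col ?D)" and 0: "?D *\<^sub>v v = 0\<^sub>v (dim_row ?D)"
  show "v = 0\<^sub>v (dim_col ?D)"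
  proof (rule eq_vecI)
    fix j assume "j < dim_vec (0\<^sub>v (dim_col ?D))"
    then have j: "j < m - 1"
      by (simp add: delete_col_def)
    \<comment> \<open>Row \<open>i\<close>, the original position of the surviving column
      \<open>j\<close>, is the unit vector that reads off \<open>v $ j\<close>.\<close>
    define i where "i = (if j < k then j else Suc j)"
    have i: "i < m"
      using j by (auto simp: i_def)
    have "row ?D i = unit_vec (m - 1) j"
      using i j by (intro eq_vecI) (auto simp: delete_col_def i_def)
    moreover have "dim_row ?D = m" "dim_col ?D = m - 1"
      by (simp_all add: delete_col_def)
    moreover from this have "v \<in> carrier_vec (m - 1)"
      using v by simp
    ultimately have "(?D *\<^sub>v v) $ i = v $ j"
      using i j by simp
    then show "v $ j = 0\<^sub>v (dim_col ?D) $ j"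
      using 0 i j \<open>dim_row ?D = m\<close> \<open>dim_col ?D = m - 1\<close> by simp
  qed (use v in simp)
qed

lemma full_col_rank_delete_col:
  fixes A :: "'a :: semiring_1 mat"
  assumes "full_col_rank A"
  shows "full_col_rank (delete_col k A)"
proof -
  have "A \<in> carrier_mat (dim_row A) (dim_col A)"
    by simp
  from delete_col_eq_mult[OF this] full_col_rank_mult[OF this] show ?thesis
    using assms delete_col_carrier full_col_rank_delete_col_one by (metis one_carrier_mat)
qed

section \<open>Gram matrices and least squares projections\<close>

lemma scalar_prod_self_eq_0_iff:
  fixes v :: "real vec"
  shows "v \<bullet> v = 0 \<longleftrightarrow> v = 0\<^sub>v (dim_vec v)"
proof
  assume "v \<bullet> v = 0"
  then have "\<forall>i<dim_vec v. v $ i = 0"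
    by (simp add: scalar_prod_def sum_nonneg_eq_0_iff)
  then show "v = 0\<^sub>v (dim_vec v)"
    by (intro eq_vecI) auto
next
  assume "v = 0\<^sub>v (dim_vec v)"
  then show "v \<bullet> v = 0"
    by (metis carrier_vec_dim_vec scalar_prod_left_zero)
qed

text \<open>If \<open>A'A v = 0\<close> then \<open>Av . Av = A'Av . v = 0\<close>, so
  \<open>Av = 0\<close> and \<open>v = 0\<close> by injectivity. Hence \<open>the\<close> in
  \<open>proj_mat\<close> is applied to a genuine inverse.\<close>

lemma gram_inverse:
  fixes A :: "real mat"
  assumes A: "A \<in> carrier_mat n m" and inj: "full_col_rank A"
  obtains G where "mat_inverse (A\<^sup>T * A) = Some G" "G \<in> carrier_mat m m"
    "(A\<^sup>T * A) * G = 1\<^sub>m m" "G * (A\<^sup>T * A) = 1\<^sub>m m"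
proof -
  have AA: "A\<^sup>T * A \<in> carrier_mat m m"
    using A by simp
  have "det (A\<^sup>T * A) \<noteq> 0"
  proof
    assume "det (A\<^sup>T * A) = 0"
    then obtain v where v: "v \<in> carrier_vec m" "v \<noteq> 0\<^sub>v m" "A\<^sup>T * A *\<^sub>v v = 0\<^sub>v m"
      using det_0_iff_vec_prod_zero_field[OF AA] by blast
    have "(A *\<^sub>v v) \<bullet> (A *\<^sub>v v) = (A\<^sup>T *\<^sub>v (A *\<^sub>v v)) \<bullet> v"
      using A v(1) by (intro transpose_vec_mult_scalar[symmetric]) auto
    also have "A\<^sup>T *\<^sub>v (A *\<^sub>v v) = 0\<^sub>v m"
      using A v by simp
    finally have "A *\<^sub>v v = 0\<^sub>v n"
      using A v(1) by (simp add: scalar_prod_self_eq_0_iff)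
    then show False
      using full_col_rankD[OF inj A] v by blast
  qed
  then have "A\<^sup>T * A \<in> Units (ring_mat TYPE(real) m ())"
    by (rule det_non_zero_imp_unit[OF AA])
  then obtain G where "mat_inverse (A\<^sup>T * A) = Some G"
    using mat_inverse(1)[OF AA, of "()"] by (cases "mat_inverse (A\<^sup>T * A)") auto
  with mat_inverse(2)[OF AA this] that show thesis
    by blast
qed

text \<open>First half of the characterization of the fit: it lies in the column space and solves
  the normal equations.\<close>

lemma proj_mat_range:
  assumes A: "A \<in> carrier_mat n m" and inj: "full_col_rank A" and v: "v \<in> carrier_vec n"
  obtains b where "b \<in> carrier_vec m" "proj_mat A *\<^sub>v v = A *\<^sub>v b"
    "A\<^sup>T *\<^sub>v (proj_mat A *\<^sub>v v) = A\<^sup>T *\<^sub>v v"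
proof -
  obtain G where G: "mat_inverse (A\<^sup>T * A) = Some G" "G \<in> carrier_mat m m"
    "(A\<^sup>T * A) * G = 1\<^sub>m m"
    using gram_inverse[OF A inj] by metis
  define b where "b = G *\<^sub>v (A\<^sup>T *\<^sub>v v)"
  have b: "b \<in> carrier_vec m"
    using A G v by (simp add: b_def)
  have eq: "proj_mat A *\<^sub>v v = A *\<^sub>v b"
    using A G v by (simp add: proj_mat_def b_def assoc_mult_mat_vec[of _ n m _ n])
  have "A\<^sup>T *\<^sub>v (A *\<^sub>v b) = (A\<^sup>T * A) *\<^sub>v b"
    using A b by simp
  also have "\<dots> = ((A\<^sup>T * A) * G) *\<^sub>v (A\<^sup>T *\<^sub>v v)"
    unfolding b_def using A G v by (subst assoc_mult_mat_vec[of _ m m _ m]) auto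
  also have "\<dots> = A\<^sup>T *\<^sub>v v"
    using A v by (simp add: G)
  finally show thesis
    using that[OF b eq] eq by simp
qed

text \<open>Second half: cancelling the invertible Gram matrix shows that the normal equations
  determine the coefficients. Fits are identified below by this rule, without computing any
  inverse.\<close>

lemma proj_mat_eqI:
  assumes A: "A \<in> carrier_mat n m" and inj: "full_col_rank A" and v: "v \<in> carrier_vec n"
    and b: "b \<in> carrier_vec m" and eq: "A\<^sup>T *\<^sub>v (A *\<^sub>v b) = A\<^sup>T *\<^sub>v v"
  shows "proj_mat A *\<^sub>v v = A *\<^sub>v b"
proof -
  obtain G where G: "mat_inverse (A\<^sup>T * A) = Some G" "G \<in> carrier_mat m m"
    "G * (A\<^sup>T * A) = 1\<^sub>m m"
    using gram_inverse[OF A inj] by metis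
  have "proj_mat A *\<^sub>v v = A *\<^sub>v (G *\<^sub>v (A\<^sup>T *\<^sub>v v))"
    using A G v by (simp add: proj_mat_def assoc_mult_mat_vec[of _ n m _ n])
  also have "A\<^sup>T *\<^sub>v v = (A\<^sup>T * A) *\<^sub>v b"
    using A b eq by simp
  also have "G *\<^sub>v \<dots> = (G * (A\<^sup>T * A)) *\<^sub>v b"
    using A G b by (intro assoc_mult_mat_vec[symmetric, of _ m m _ m]) auto
  also have "\<dots> = b"
    using b by (simp add: G)
  finally show ?thesis .
qed

section \<open>Centering and its matrix \<open>I - M_e\<close>\<close>

definition center :: "real vec \<Rightarrow> real vec" where
  "center v = vec (dim_vec v) (\<lambda>n. v $ n - vec_mean v)"

lemma center_carrier [simp]: "center v \<in> carrier_vec n \<longleftrightarrow> v \<in> carrier_vec n"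
  unfolding carrier_vec_def center_def by simp

lemma ones_vec_scalar_prod:
  assumes "v \<in> carrier_vec n" "0 < n"
  shows "ones_vec n \<bullet> v = real n * vec_mean v"
  using assms by (auto simp: scalar_prod_def ones_vec_def vec_mean_def lessThan_atLeast0)

lemma center_scalar_prod_center:
  assumes v: "v \<in> carrier_vec n" and w: "w \<in> carrier_vec n" and n: "0 < n"
  shows "center v \<bullet> center w = v \<bullet> w - real n * vec_mean v * vec_mean w"
proof -
  have sums: "(\<Sum>i<n. v $ i) = real n * vec_mean v" "(\<Sum>i<n. w $ i) = real n * vec_mean w"
    using v w n by (auto simp: vec_mean_def)
  have "center v \<bullet> center w = (\<Sum>i<n. (v $ i - vec_mean v) * (w $ i - vec_mean w))"
    using v w by (auto simp: scalar_prod_def center_def lessThan_atLeast0)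
  also have "\<dots> = (\<Sum>i<n. v $ i * w $ i) - (\<Sum>i<n. v $ i) * vec_mean w
      - vec_mean v * (\<Sum>i<n. w $ i) + real n * vec_mean v * vec_mean w"
    by (simp add: algebra_simps sum.distrib sum_subtractf sum_distrib_left sum_distrib_right)
  also have "\<dots> = v \<bullet> w - real n * vec_mean v * vec_mean w"
    using v w unfolding sums by (auto simp: scalar_prod_def lessThan_atLeast0)
  finally show ?thesis .
qed

text \<open>The part of \<open>v\<close> removed by centering is a multiple of \<open>e\<close>,
  which is orthogonal to \<open>center v\<close>. This turns the quadratic forms in
  \<open>R2_const\<close> into squared norms.\<close>

lemma scalar_prod_center:
  assumes v: "v \<in> carrier_vec n" and n: "0 < n"
  shows "v \<bullet> center v = center v \<bullet> center v"
proof -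
  have "v \<bullet> center v = (\<Sum>i<n. v $ i * v $ i) - vec_mean v * (\<Sum>i<n. v $ i)"
    using v by (auto simp: scalar_prod_def center_def lessThan_atLeast0 algebra_simps
        sum_subtractf sum_distrib_left)
  also have "\<dots> = v \<bullet> v - real n * vec_mean v * vec_mean v"
    using v n by (auto simp: vec_mean_def scalar_prod_def lessThan_atLeast0)
  finally show ?thesis
    using center_scalar_prod_center[OF v v n] by simp
qed

lemma M_e_mult_vec:
  assumes v: "v \<in> carrier_vec n" and n: "0 < n"
  shows "M_e n *\<^sub>v v = vec_mean v \<cdot>\<^sub>v ones_vec n"
proof -
  let ?E = "mat_of_cols n [ones_vec n]"
  have E: "?E \<in> carrier_mat n 1"
    by (simp add: mat_of_cols_def)
  have E_mult: "?E *\<^sub>v b = b $ 0 \<cdot>\<^sub>v ones_vec n" if "b \<in> carrier_vec 1" for b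
    using that by (intro eq_vecI) (auto simp: scalar_prod_def ones_vec_def mat_of_cols_def)
  have inj: "full_col_rank ?E"
    unfolding full_col_rank_def
  proof (intro ballI impI)
    fix b assume b: "b \<in> carrier_vec (dim_col ?E)" and 0: "?E *\<^sub>v b = 0\<^sub>v (dim_row ?E)"
    then have "(b $ 0 \<cdot>\<^sub>v ones_vec n) $ 0 = 0"
      using n E_mult by simp
    then have "b $ 0 = 0"
      using n by (simp add: ones_vec_def)
    then show "b = 0\<^sub>v (dim_col ?E)"
      using b by (intro eq_vecI) auto
  qed
  \<comment> \<open>The normal equation for the single regressor \<open>e\<close> is
    \<open>n * b = e'v\<close>, so its coefficient is the mean.\<close>
  define b where "b = vec (Suc 0) (\<lambda>_. vec_mean v)"
  have b: "b \<in> carrier_vec 1"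
    by (simp add: b_def)
  have Eb: "?E *\<^sub>v b = vec_mean v \<cdot>\<^sub>v ones_vec n"
    using E_mult[OF b] by (simp add: b_def)
  have ones: "ones_vec n \<in> carrier_vec n" "ones_vec n \<bullet> ones_vec n = real n"
    by (auto simp: ones_vec_def scalar_prod_def)
  have "?E\<^sup>T *\<^sub>v (vec_mean v \<cdot>\<^sub>v ones_vec n) = ?E\<^sup>T *\<^sub>v v"
    using ones ones_vec_scalar_prod[OF v n]
    by (intro eq_vecI) (auto simp: scalar_prod_smult_distrib[of _ n])
  then show ?thesis
    using proj_mat_eqI[OF E inj v b] Eb by (simp add: M_e_def)
qed

lemma residual_maker_mult_vec:
  assumes v: "v \<in> carrier_vec n" and n: "0 < n"
  shows "(1\<^sub>m n - M_e n) *\<^sub>v v = center v"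
proof -
  have "M_e n \<in> carrier_mat n n"
    by (auto simp: M_e_def proj_mat_def)
  then have "(1\<^sub>m n - M_e n) *\<^sub>v v = v - M_e n *\<^sub>v v"
    using v by (subst minus_mult_distrib_mat_vec[of _ n n]) auto
  also have "\<dots> = center v"
    unfolding M_e_mult_vec[OF v n] using v
    by (intro eq_vecI) (auto simp: center_def ones_vec_def)
  finally show ?thesis .
qed

section \<open>Standardization\<close>

text \<open>This is the Euclidean norm of \<open>center v\<close>; naming it exhibits
  \<open>standardize\<close> as a scalar multiple of centering.\<close>

definition scale :: "real vec \<Rightarrow> real" where
  "scale v = sqrt (real (dim_vec v)) * vec_sd v"

lemma standardize_eq: "standardize v = (1 / scale v) \<cdot>\<^sub>v center v"
  by (intro eq_vecI) (auto simp: standardize_def scale_def center_def)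

lemma center_eq_0_if_scale_eq_0:
  assumes "v \<in> carrier_vec n" "scale v = 0"
  shows "center v = 0\<^sub>v n"
proof (rule eq_vecI)
  fix i assume i: "i < dim_vec (0\<^sub>v n :: real vec)"
  \<comment> \<open>The index \<open>i\<close> excludes the empty vector, so the factor that
    vanishes is \<open>vec_sd v\<close>.\<close>
  then have "(\<Sum>n<dim_vec v. (v $ n - vec_mean v)\<^sup>2) = 0"
    using assms by (auto simp: scale_def vec_sd_def)
  then have "\<forall>n<dim_vec v. v $ n = vec_mean v"
    by (simp add: sum_nonneg_eq_0_iff)
  then show "center v $ i = 0\<^sub>v n $ i"
    using i assms(1) by (simp add: center_def)
qed (use assms in \<open>simp add: center_def\<close>)

lemma standardized_mat_carrier:
  assumes "X \<in> carrier_mat n m"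
  shows "standardized_mat X \<in> carrier_mat n (m - 1)"
  using assms by (simp add: standardized_mat_def)

lemma col_standardized_mat:
  assumes "X \<in> carrier_mat n m" "Suc j < m"
  shows "col (standardized_mat X) j = standardize (col X (Suc j))"
  using assms by (intro eq_vecI) (auto simp: standardized_mat_def standardize_def)

text \<open>The shift to \<open>Suc k\<close> reflects that standardization drops column 0; that
  column is never the deleted one.\<close>

lemma delete_col_standardized_mat:
  assumes X: "X \<in> carrier_mat n m"
  shows "delete_col k (standardized_mat X) = standardized_mat (delete_col (Suc k) X)"
proof (rule eq_matI)
  fix i j
  assume "i < dim_row (standardized_mat (delete_col (Suc k) X))"
    and "j < dim_col (standardized_mat (delete_col (Suc k) X))"
  then show "delete_col k (standardized_mat X) $$ (i, j) =
      standardized_mat (delete_col (Suc k) X) $$ (i, j)"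
    using X col_delete_col[OF X, of "Suc j" "Suc k"]
    by (auto simp: delete_col_def standardized_mat_def)
qed (use X in \<open>auto simp: delete_col_def standardized_mat_def\<close>)

section \<open>Designs containing the constant column\<close>

text \<open>Stated as a locale because it is instantiated twice: with the full design and with the
  design of the remaining regressors.\<close>

locale design_with_constant =
  fixes X :: "real mat" and n m :: nat
  assumes carrier: "X \<in> carrier_mat n m"
    and inj: "full_col_rank X"
    and col_0: "col X 0 = ones_vec n"
    and n_pos: "0 < n" and m_pos: "0 < m"
begin

text \<open>A vector with zero centering is a multiple of \<open>e\<close>, that is, of column 0. By
  injectivity \<open>b\<close> is then a multiple of the unit vector at 0.\<close>

lemma center_mult_eq_0_imp:
  assumes b: "b \<in> carrier_vec m" and 0: "center (X *\<^sub>v b) = 0\<^sub>v n" and i: "0 < i" "i < m"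
  shows "b $ i = 0"
proof -
  define c where "c = vec_mean (X *\<^sub>v b)"
  have "X *\<^sub>v b = c \<cdot>\<^sub>v ones_vec n"
  proof (rule eq_vecI)
    fix j assume "j < dim_vec (c \<cdot>\<^sub>v ones_vec n)"
    then have j: "j < n"
      by (simp add: ones_vec_def)
    have "center (X *\<^sub>v b) $ j = 0"
      unfolding 0 using j by simp
    then show "(X *\<^sub>v b) $ j = (c \<cdot>\<^sub>v ones_vec n) $ j"
      using j carrier by (simp add: center_def c_def ones_vec_def)
  qed (use carrier in \<open>simp add: ones_vec_def\<close>)
  also have "\<dots> = X *\<^sub>v (c \<cdot>\<^sub>v unit_vec m 0)"
  proof -
    have "X *\<^sub>v unit_vec m 0 = col X 0"
      using carrier m_pos by (intro eq_vecI) auto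
    then show ?thesis
      using col_0 carrier by (simp add: mult_mat_vec[OF carrier])
  qed
  finally have "X *\<^sub>v (b - c \<cdot>\<^sub>v unit_vec m 0) = 0\<^sub>v n"
    using b carrier by (subst mult_minus_distrib_mat_vec[OF carrier]) auto
  then have "b - c \<cdot>\<^sub>v unit_vec m 0 = 0\<^sub>v m"
    using full_col_rankD[OF inj carrier] b by simp
  then have "(b - c \<cdot>\<^sub>v unit_vec m 0) $ i = 0"
    using i by simp
  then show ?thesis
    using i b by simp
qed

text \<open>This is the positivity of the standard deviations, a consequence of the rank: a column
  of zero scale would force its own coefficient 1 to vanish.\<close>

lemma scale_nonzero:
  assumes "Suc j < m"
  shows "scale (col X (Suc j)) \<noteq> 0"
proof
  assume "scale (col X (Suc j)) = 0"
  moreover have col: "X *\<^sub>v unit_vec m (Suc j) = col X (Suc j)"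
    using carrier assms by (intro eq_vecI) auto
  ultimately have "center (X *\<^sub>v unit_vec m (Suc j)) = 0\<^sub>v n"
    using center_eq_0_if_scale_eq_0 carrier by auto
  from center_mult_eq_0_imp[OF _ this, of "Suc j"] show False
    using assms by simp
qed

text \<open>Centering is linear, kills column 0, and sends every other column to
  \<open>scale\<close> times its standardized version; the coefficients are rescaled and shifted
  accordingly.\<close>

lemma center_mult:
  assumes b: "b \<in> carrier_vec m"
  shows "center (X *\<^sub>v b) =
    standardized_mat X *\<^sub>v vec (m - 1) (\<lambda>j. scale (col X (Suc j)) * b $ Suc j)"
proof (rule eq_vecI)
  fix i assume "i < dim_vec (standardized_mat X *\<^sub>v
    vec (m - 1) (\<lambda>j. scale (col X (Suc j)) * b $ Suc j))"
  then have i: "i < n"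
    using carrier by (simp add: standardized_mat_def)
  have entry: "(X *\<^sub>v b) $ l = (\<Sum>j<m. X $$ (l, j) * b $ j)" if "l < n" for l
    using that b carrier by (auto simp: scalar_prod_def lessThan_atLeast0)
  have mean: "vec_mean (X *\<^sub>v b) = (\<Sum>j<m. vec_mean (col X j) * b $ j)"
  proof -
    have "(\<Sum>l<n. (X *\<^sub>v b) $ l) = (\<Sum>l<n. \<Sum>j<m. X $$ (l, j) * b $ j)"
      using entry by simp
    also have "\<dots> = (\<Sum>j<m. \<Sum>l<n. X $$ (l, j) * b $ j)"
      by (rule sum.swap)
    finally show ?thesis
      using carrier by (simp add: vec_mean_def sum_distrib_left sum_distrib_right mult.assoc)
  qed
  \<comment> \<open>Each entry of the constant column equals its mean, so the term for index 0 drops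
    out of the centered sum.\<close>
  have "vec_mean (col X 0) = X $$ (i, 0)"
  proof -
    have "X $$ (i, 0) = col X 0 $ i"
      using carrier i m_pos by simp
    then show ?thesis
      using i unfolding col_0 by (simp add: vec_mean_def ones_vec_def)
  qed
  then have "center (X *\<^sub>v b) $ i =
      (\<Sum>j<m - 1. (X $$ (i, Suc j) - vec_mean (col X (Suc j))) * b $ Suc j)"
    using i m_pos carrier entry[OF i]
    by (cases m) (simp_all add: center_def mean sum.lessThan_Suc_shift sum_subtractf
        left_diff_distrib del: sum.lessThan_Suc index_mult_mat_vec)
  also have "\<dots> = (\<Sum>j<m - 1. standardized_mat X $$ (i, j) * (scale (col X (Suc j)) * b $ Suc j))"
    using carrier i scale_nonzero
    by (intro sum.cong) (auto simp: standardized_mat_def standardize_eq center_def)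
  also have "\<dots> = (standardized_mat X *\<^sub>v vec (m - 1) (\<lambda>j. scale (col X (Suc j)) * b $ Suc j)) $ i"
    using carrier i by (simp add: standardized_mat_def scalar_prod_def lessThan_atLeast0)
  finally show "center (X *\<^sub>v b) $ i =
    (standardized_mat X *\<^sub>v vec (m - 1) (\<lambda>j. scale (col X (Suc j)) * b $ Suc j)) $ i" .
qed (use carrier in \<open>simp add: standardized_mat_def center_def\<close>)

lemma full_col_rank_standardized_mat: "full_col_rank (standardized_mat X)"
  unfolding full_col_rank_def
proof (intro ballI impI)
  let ?Z = "standardized_mat X"
  fix g assume "g \<in> carrier_vec (dim_col ?Z)" and 0: "?Z *\<^sub>v g = 0\<^sub>v (dim_row ?Z)"
  then have g: "g \<in> carrier_vec (m - 1)"
    using standardized_mat_carrier[OF carrier] by simp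
  \<comment> \<open>Inverts the rescaling of \<open>center_mult\<close>. At index 0, where
    \<open>i - 1\<close> truncates to 0, the coefficient only adds a multiple of \<open>e\<close>,
    which centering removes.\<close>
  define b where "b = vec m (\<lambda>i. g $ (i - 1) / scale (col X i))"
  have b: "b \<in> carrier_vec m"
    by (simp add: b_def)
  have "vec (m - 1) (\<lambda>j. scale (col X (Suc j)) * b $ Suc j) = g"
    using g scale_nonzero by (intro eq_vecI) (auto simp: b_def)
  then have "center (X *\<^sub>v b) = 0\<^sub>v n"
    using center_mult[OF b] 0 standardized_mat_carrier[OF carrier] by simp
  then have "b $ Suc j = 0" if "Suc j < m" for j
    using center_mult_eq_0_imp[OF b] that by simp
  then have "g $ j = 0" if "Suc j < m" for j
    using that scale_nonzero by (simp add: b_def)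
  then show "g = 0\<^sub>v (dim_col ?Z)"
    using g standardized_mat_carrier[OF carrier] by (intro eq_vecI) auto
qed

text \<open>The normal equation for the constant column says that \<open>w\<close> and
  \<open>v\<close> have equal means. Passing to centered vectors therefore subtracts the same
  correction from both sides of every other equation.\<close>

lemma standardized_mat_normal_eq:
  assumes v: "v \<in> carrier_vec n" and w: "w \<in> carrier_vec n" and eq: "X\<^sup>T *\<^sub>v w = X\<^sup>T *\<^sub>v v"
  shows "(standardized_mat X)\<^sup>T *\<^sub>v center w = (standardized_mat X)\<^sup>T *\<^sub>v center v"
proof (rule eq_vecI)
  have cols: "col X j \<bullet> w = col X j \<bullet> v" if "j < m" for j
  proof -
    have "(X\<^sup>T *\<^sub>v w) $ j = (X\<^sup>T *\<^sub>v v) $ j"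
      by (simp add: eq)
    then show ?thesis
      using that carrier by simp
  qed
  have mean: "vec_mean w = vec_mean v"
    using cols[OF m_pos] ones_vec_scalar_prod[OF v n_pos] ones_vec_scalar_prod[OF w n_pos] n_pos
    by (simp add: col_0)
  fix j assume "j < dim_vec ((standardized_mat X)\<^sup>T *\<^sub>v center v)"
  then have j: "Suc j < m"
    using standardized_mat_carrier[OF carrier] by auto
  have x: "col X (Suc j) \<in> carrier_vec n"
    using carrier by auto
  have "standardize (col X (Suc j)) \<bullet> center w = standardize (col X (Suc j)) \<bullet> center v"
    using x v w by (simp add: standardize_eq smult_scalar_prod_distrib[of _ n]
        center_scalar_prod_center[OF x _ n_pos] cols[OF j] mean)
  then show "((standardized_mat X)\<^sup>T *\<^sub>v center w) $ j = ((standardized_mat X)\<^sup>T *\<^sub>v center v) $ j"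
    using j standardized_mat_carrier[OF carrier] by (simp add: col_standardized_mat[OF carrier j])
qed simp

text \<open>The centered fit is in the column space by \<open>center_mult\<close> and solves the
  normal equations by \<open>standardized_mat_normal_eq\<close>, so \<open>proj_mat_eqI\<close>
  applies. The scalar \<open>c\<close> is carried along because the standardized response is a
  multiple of the centered one.\<close>

lemma proj_standardized_mat:
  assumes v: "v \<in> carrier_vec n"
  shows "proj_mat (standardized_mat X) *\<^sub>v (c \<cdot>\<^sub>v center v) = c \<cdot>\<^sub>v center (proj_mat X *\<^sub>v v)"
proof -
  let ?Z = "standardized_mat X" and ?w = "proj_mat X *\<^sub>v v"
  have Z: "?Z \<in> carrier_mat n (m - 1)"
    by (rule standardized_mat_carrier[OF carrier])
  obtain b where b: "b \<in> carrier_vec m" "?w = X *\<^sub>v b" "X\<^sup>T *\<^sub>v ?w = X\<^sup>T *\<^sub>v v"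
    using proj_mat_range[OF carrier inj v] by metis
  have w: "?w \<in> carrier_vec n"
    using b carrier by simp
  obtain g where g: "g \<in> carrier_vec (m - 1)" "center ?w = ?Z *\<^sub>v g"
    using center_mult[OF b(1)] b(2) by force
  have Zcg: "?Z *\<^sub>v (c \<cdot>\<^sub>v g) = c \<cdot>\<^sub>v center ?w"
    using g mult_mat_vec[OF Z] by simp
  have "?Z\<^sup>T *\<^sub>v (c \<cdot>\<^sub>v center ?w) = ?Z\<^sup>T *\<^sub>v (c \<cdot>\<^sub>v center v)"
    using Z v w standardized_mat_normal_eq[OF v w b(3)]
    by (simp add: mult_mat_vec[of _ "m - 1" n])
  then show ?thesis
    using proj_mat_eqI[OF Z full_col_rank_standardized_mat, of "c \<cdot>\<^sub>v center v" "c \<cdot>\<^sub>v g"] v g Zcg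
    by simp
qed

end

section \<open>Equality of the two coefficients of determination\<close>

theorem lemma4p1:
  fixes X :: "real mat" and N K k :: nat
  assumes "2 \<le> K" and "K < N"
    and "X \<in> carrier_mat N K"
    and "vec_space.rank N X = K"
    and "col X 0 = ones_vec N"
    and "1 \<le> k" and "k < K"
  shows "R2_const X k = R2_centered (standardized_mat X) (k - 1)"
proof -
  let ?Z = "standardized_mat X"
  obtain i where k: "k = Suc i"
    using \<open>1 \<le> k\<close> by (cases k) auto
  have N: "0 < N"
    using assms by simp
  have inj: "full_col_rank X"
    using vec_space.full_col_rank_if_rank assms by blast
  interpret X: design_with_constant X N K
    using assms inj by unfold_locales auto
  \<comment> \<open>As \<open>k >= 1\<close>, the constant column stays at position 0. For
    \<open>K = 2\<close> it is the only regressor left, and the standardized design has no columns;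
    the locale covers this case too.\<close>
  interpret A: design_with_constant "delete_col k X" N "K - 1"
    using assms(1,2,5-7) inj col_delete_col[OF X.carrier, of 0 k] delete_col_carrier[OF X.carrier, of k]
    by unfold_locales (auto simp: full_col_rank_delete_col)
  let ?x = "col X k" and ?w = "ls_fit X k"
  \<comment> \<open>The common factor: it relates both the response \<open>z\<close> and its fit to
    the centered versions of \<open>?x\<close> and \<open>?w\<close>.\<close>
  define c where "c = 1 / scale ?x"
  have c: "c \<noteq> 0"
    using X.scale_nonzero[of i] \<open>k < K\<close> by (simp add: c_def k)
  have x: "?x \<in> carrier_vec N"
    using assms by auto
  have w: "?w \<in> carrier_vec N"
    using carrier_matD(1)[OF A.carrier]
    by (intro carrier_vecI) (simp add: ls_fit_def proj_mat_def)
  have z: "col ?Z i = c \<cdot>\<^sub>v center ?x"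
    using col_standardized_mat[OF X.carrier] \<open>k < K\<close> by (simp add: k standardize_eq c_def)
  have fit: "ls_fit ?Z i = c \<cdot>\<^sub>v center ?w"
    using A.proj_standardized_mat[OF x, of c]
    by (simp add: ls_fit_def z delete_col_standardized_mat[OF X.carrier] k)
  have "R2_const X k = (center ?w \<bullet> center ?w) / (center ?x \<bullet> center ?x)"
    using X.carrier x w N
    by (simp add: R2_const_def residual_maker_mult_vec scalar_prod_center)
  \<comment> \<open>Numerator and denominator both acquire the nonzero factor \<open>c * c\<close>,
    which cancels.\<close>
  also have "\<dots> = R2_centered ?Z (k - 1)"
    using c x w
    by (simp add: R2_centered_def fit z k smult_scalar_prod_distrib[of _ N]
        scalar_prod_smult_distrib[of _ N])
  finally show ?thesis .
qed

end
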